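(* Let $\Sigma=\{a,b,c\}$ and $w,w'\in\Sigma^*$. Let $t\ge 1$ and $0\le t'\le t''\le t$ be integers, and suppose $w$ contains $t$ (specified occurrences of) factors $\beta_1,\dots,\beta_t$ of the form $$\beta_k=\begin{cases} ab\,x_k\,ba & \text{for } 1\le k\le t',\\ bc\,x_k\,cb & \text{for } t'+1\le k\le t'',\\ ca\,x_k\,ac & \text{for } t''+1\le k\le t,\end{cases}$$ such that the following conditions hold: (1) $x_k\in\Sigma^*$ for $1\le k\le t$; (2) the first two and last two characters of $\beta_m$ do not overlap, as positions in $w$, with the first two and last two characters of $\beta_n$ whenever $m\ne n$; (3) $\sum_{k=1}^{t'}|x_k|_c=\sum_{k=t'+1}^{t''}|x_k|_a=\sum_{k=t''+1}^{t}|x_k|_b$. If $w'$ is obtained from $w$ by simultaneously rewriting, for every $1\le k\le t$, $\beta_k$ into $\beta_k'$, where $$\beta_k'=\begin{cases} ba\,x_k\,ab & \text{for } 1\le k\le t',\\ cb\,x_k\,bc & \text{for } t'+1\le k\le t'',\\ ac\,x_k\,ca & \text{for } t''+1\le k\le t\end{cases}$$ (that is, by swapping the two letters in each of the $2t$ displayed pairs), then $w$ and $w'$ are strongly $M$-equivalent.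
   Context: $\Sigma^*$ is the set of all finite words over $\Sigma$. For words $v,w$, $|w|_v$ is the number of occurrences of $v$ as a scattered subword (subsequence) of $w$, occurrences being distinguished by their positions; in particular $|w|_c$ is the number of letters $c$ in $w$. A factor of $w$ is a contiguous subword: $v$ is a factor of $w$ if $w=xvy$ for some words $x,y$. The factors $\beta_k$ may be nested or overlap one another, as long as the displayed pairs do not overlap. For an ordered alphabet $a_1<a_2<\cdots<a_k$, the Parikh matrix mapping is the monoid morphism from words to $(k+1)\times(k+1)$ upper triangular nonnegative integer matrices with unit diagonal, sending $a_q$ to the identity matrix with an additional $1$ in position $(q,q+1)$. Equivalently, the $(i,j+1)$ entry of the matrix of $w$ is $|w|_{a_ia_{i+1}\cdots a_j}$ for $1\le i\le j\le k$. Two words are $M$-equivalent with respect to an ordered alphabet if they have the same Parikh matrix with respect to it. Two words $w,w'\in\Sigma^*$ are strongly $M$-equivalent if they are $M$-equivalent with respect to every total ordering of the alphabet $\Sigma$. *)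

theory Defs
  imports "Jordan_Normal_Form.Matrix"
begin

text \<open>
  An ordered alphabet \<open>a\<^sub>1 < \<dots> < a\<^sub>k\<close> is the distinct list \<open>[a\<^sub>1, \<dots>, a\<^sub>k]\<close>. Matrix rows and
  columns, list entries and positions in words are all counted from 0, so the letter \<open>as ! i\<close>
  has its additional 1 in position \<open>(i, i + 1)\<close>.
\<close>

definition letter_mat :: "'a list \<Rightarrow> 'a \<Rightarrow> nat mat" where
  "letter_mat as s = mat (length as + 1) (length as + 1)
     (\<lambda>(i, j). if i = j \<or> (j = i + 1 \<and> as ! i = s) then 1 else 0)"

definition parikh_mat :: "'a list \<Rightarrow> 'a list \<Rightarrow> nat mat" where
  "parikh_mat as w = foldr (\<lambda>s M. letter_mat as s * M) w (1\<^sub>m (length as + 1))"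

lemma letter_mat_carrier [simp]:
  "letter_mat as s \<in> carrier_mat (length as + 1) (length as + 1)"
  by (simp add: letter_mat_def)

lemma parikh_mat_Nil [simp]: "parikh_mat as [] = 1\<^sub>m (length as + 1)"
  by (simp add: parikh_mat_def)

lemma parikh_mat_Cons: "parikh_mat as (s # w) = letter_mat as s * parikh_mat as w"
  by (simp add: parikh_mat_def)

lemma parikh_mat_carrier [simp]:
  "parikh_mat as w \<in> carrier_mat (length as + 1) (length as + 1)"
proof (induction w)
  case Nil
  show ?case by simp
next
  case (Cons s w)
  show ?case
    unfolding parikh_mat_Cons by (rule mult_carrier_mat[OF letter_mat_carrier Cons.IH])
qed

lemma parikh_mat_singleton: "parikh_mat as [s] = letter_mat as s"
  using right_mult_one_mat[OF letter_mat_carrier] by (simp add: parikh_mat_Cons)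

lemma parikh_mat_append: "parikh_mat as (u @ v) = parikh_mat as u * parikh_mat as v"
proof (induction u)
  case Nil
  show ?case
    unfolding append_Nil parikh_mat_Nil by (rule left_mult_one_mat[OF parikh_mat_carrier, symmetric])
next
  case (Cons s u)
  show ?case
    unfolding append_Cons parikh_mat_Cons Cons.IH
    by (rule assoc_mult_mat[OF letter_mat_carrier parikh_mat_carrier parikh_mat_carrier, symmetric])
qed

definition M_equivalent :: "'a list \<Rightarrow> 'a list \<Rightarrow> 'a list \<Rightarrow> bool" where
  "M_equivalent as w w' \<longleftrightarrow> parikh_mat as w = parikh_mat as w'"

definition strongly_M_equivalent :: "'a set \<Rightarrow> 'a list \<Rightarrow> 'a list \<Rightarrow> bool" where
  "strongly_M_equivalent \<Sigma> w w' \<longleftrightarrow>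
     (\<forall>as. distinct as \<and> set as = \<Sigma> \<longrightarrow> M_equivalent as w w')"

definition factor_at :: "'a list \<Rightarrow> nat \<Rightarrow> 'a list \<Rightarrow> bool" where
  "factor_at v p w \<longleftrightarrow> (\<exists>y z. w = y @ v @ z \<and> length y = p)"

text \<open>The positions in the ambient word of the first two and last two characters of \<open>v\<close>,
  for the occurrence of \<open>v\<close> that starts at position \<open>p\<close>; only used when \<open>length v \<ge> 4\<close>.\<close>

definition end_positions :: "'a list \<Rightarrow> nat \<Rightarrow> nat set" where
  "end_positions v p = {p, p + 1, p + length v - 2, p + length v - 1}"

text \<open>
  Since the occurrences may be nested or overlap, the interior of one of them may itself be altered
  by the rewriting of another. Hence only the end positions of the occurrence \<open>k\<close> receive
  their letters from \<open>\<beta>' k\<close>, and every position outside all the end positions keeps its letter.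
\<close>

definition rewrites_to ::
  "nat set \<Rightarrow> (nat \<Rightarrow> nat) \<Rightarrow> (nat \<Rightarrow> 'a list) \<Rightarrow> (nat \<Rightarrow> 'a list) \<Rightarrow> 'a list \<Rightarrow> 'a list \<Rightarrow> bool" where
  "rewrites_to K p \<beta> \<beta>' w w' \<longleftrightarrow>
     length w' = length w \<and>
     (\<forall>k\<in>K. \<forall>i\<in>end_positions (\<beta> k) (p k). w' ! i = \<beta>' k ! (i - p k)) \<and>
     (\<forall>i<length w. i \<notin> (\<Union>k\<in>K. end_positions (\<beta> k) (p k)) \<longrightarrow> w' ! i = w ! i)"

end

theory Submission
  imports Defs
begin

text \<open>
  For distinct letters \<open>x1, x2, x3\<close>, the Parikh matrix of a word with respect to \<open>x1 < x2 < x3\<close>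
  records how often the words \<open>x1\<close>, \<open>x2\<close>, \<open>x3\<close>, \<open>x1 x2\<close>, \<open>x2 x3\<close> and \<open>x1 x2 x3\<close>
  occur in it as scattered subwords. The rewriting is a set of transpositions of adjacent letters at
  pairwise disjoint pairs of positions, so it is enough to know what such a set does to these
  numbers.

  A transposition of adjacent letters \<open>d e\<close> affects only the occurrences that use both letters. For
  \<open>x1 x2\<close> the change depends on \<open>d\<close> and \<open>e\<close> alone. For \<open>x1 x2 x3\<close> it depends also on the
  number of letters \<open>x3\<close> to the right of the pair, if \<open>{d, e} = {x1, x2}\<close>, or of letters \<open>x1\<close> to
  its left, if \<open>{d, e} = {x2, x3}\<close>; the lemma is \<open>subword_count_three_adjacent_swap\<close>.
  No other transposition moves a letter across the pair, so these numbers are the same before and after the others are carried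
  out. Hence the changes, all computed in the original word, simply add up
  (\<open>swaps_pairs_additive\<close>).

  The two pairs of a factor \<open>d e x e d\<close> have opposite effects. On \<open>x1 x2\<close> they cancel. On
  \<open>x1 x2 x3\<close> nothing remains if \<open>{d, e} = {x1, x3}\<close>, and otherwise what remains is, up to sign, the
  number of occurrences inside \<open>x\<close> of the letter other than \<open>d\<close> and \<open>e\<close> (\<open>factor_gain_three\<close>). For each of the six orders, exactly two of the three kinds of
  factors contribute, with opposite signs, since the pairs \<open>ab\<close>, \<open>bc\<close>, \<open>ca\<close> follow each other
  cyclically; the balance condition makes the two contributions cancel.
\<close>

section \<open>Parikh matrices count scattered subwords\<close>

fun subword_count :: "'a list \<Rightarrow> 'a list \<Rightarrow> nat" where
  "subword_count [] w = 1"
| "subword_count (x # v) [] = 0"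
| "subword_count (x # v) (y # w) = subword_count (x # v) w + (if x = y then subword_count v w else 0)"

lemma subword_count_singleton: "subword_count [x] w = count (mset w) x"
  by (induction w) auto

text \<open>
  Multiplying by the matrix of \<open>s\<close> on the left adds to each row that belongs to \<open>s\<close> the row below
  it. This is the recursion of \<open>subword_count\<close>: the first letter of the word is either skipped or
  used for the first letter of the pattern.
\<close>

lemma letter_mat_mult_index:
  assumes M: "M \<in> carrier_mat (length as + 1) (length as + 1)"
    and i: "i \<le> length as" and j: "j \<le> length as"
  shows "(letter_mat as s * M) $$ (i, j) =
    M $$ (i, j) + (if i < length as \<and> as ! i = s then M $$ (i + 1, j) else 0)"
proof -
  let ?n = "length as + 1"
  have "(letter_mat as s * M) $$ (i, j) = (\<Sum>l<?n. letter_mat as s $$ (i, l) * M $$ (l, j))"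
    using M i j by (simp add: scalar_prod_def letter_mat_def atLeast0LessThan)
  also have "\<dots> = (\<Sum>l<?n. (if l = i then M $$ (l, j) else 0) +
      (if l = i + 1 then (if as ! i = s then M $$ (l, j) else 0) else 0))"
    using i by (intro sum.cong) (auto simp: letter_mat_def)
  also have "\<dots> = M $$ (i, j) + (if i < length as \<and> as ! i = s then M $$ (i + 1, j) else 0)"
    using i by (cases "i = length as") (simp_all add: sum.distrib)
  finally show ?thesis .
qed

lemma parikh_mat_index:
  assumes "i \<le> length as" and "j \<le> length as"
  shows "parikh_mat as w $$ (i, j) = (if i \<le> j then subword_count (take (j - i) (drop i as)) w else 0)"
  using assms
proof (induction w arbitrary: i)
  case Nil
  show ?case
  proof (cases "i < j")
    case True
    then have "take (j - i) (drop i as) \<noteq> []" using Nil by simp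
    then obtain y v where "take (j - i) (drop i as) = y # v" by (meson list.exhaust)
    then show ?thesis using True Nil by simp
  qed (use Nil in auto)
next
  case (Cons s w)
  have eq: "parikh_mat as (s # w) $$ (i, j) = parikh_mat as w $$ (i, j) +
      (if i < length as \<and> as ! i = s then parikh_mat as w $$ (i + 1, j) else 0)"
    unfolding parikh_mat_Cons by (rule letter_mat_mult_index[OF parikh_mat_carrier Cons.prems])
  show ?case
  proof (cases "i < j")
    case True
    then have "drop i as = as ! i # drop (Suc i) as"
      using Cons.prems by (simp add: Cons_nth_drop_Suc)
    moreover have "j - i = Suc (j - Suc i)" using True by simp
    ultimately have "take (j - i) (drop i as) = as ! i # take (j - Suc i) (drop (Suc i) as)"
      by simp
    then show ?thesis using True Cons eq by simp
  next
    case False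
    then show ?thesis using Cons eq by auto
  qed
qed

lemma M_equivalent_ternary:
  assumes "\<And>s. s \<in> {x, y, z} \<Longrightarrow> subword_count [s] w = subword_count [s] w'"
    and "subword_count [x, y] w = subword_count [x, y] w'" and "subword_count [y, z] w = subword_count [y, z] w'"
    and "subword_count [x, y, z] w = subword_count [x, y, z] w'"
  shows "M_equivalent [x, y, z] w w'"
  unfolding M_equivalent_def
proof (rule eq_matI)
  have dims: "dim_row (parikh_mat [x, y, z] v) = 4" "dim_col (parikh_mat [x, y, z] v) = 4" for v
    using carrier_matD[OF parikh_mat_carrier[of "[x, y, z]" v]] by simp_all
  then show "dim_row (parikh_mat [x, y, z] w) = dim_row (parikh_mat [x, y, z] w')"
    "dim_col (parikh_mat [x, y, z] w) = dim_col (parikh_mat [x, y, z] w')"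
    by simp_all
  fix i j
  assume "i < dim_row (parikh_mat [x, y, z] w')" "j < dim_col (parikh_mat [x, y, z] w')"
  then have ij: "i \<le> 3" "j \<le> 3"
    by (simp_all add: dims)
  then have "i \<in> {0, 1, 2, 3}" "j \<in> {0, 1, 2, 3}" by auto
  then have "take (j - i) (drop i [x, y, z]) \<in> {[], [x], [y], [z], [x, y], [y, z], [x, y, z]}"
    by (elim insertE emptyE; simp)
  moreover have "subword_count v w = subword_count v w'" if "v \<in> {[], [x], [y], [z], [x, y], [y, z], [x, y, z]}" for v
    using that by (elim insertE emptyE; simp add: assms)
  ultimately have "subword_count (take (j - i) (drop i [x, y, z])) w = subword_count (take (j - i) (drop i [x, y, z])) w'"
    by blast
  then show "parikh_mat [x, y, z] w $$ (i, j) = parikh_mat [x, y, z] w' $$ (i, j)"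
    using ij by (simp add: parikh_mat_index)
qed

section \<open>One adjacent transposition\<close>

text \<open>
  The change in the number of subwords \<open>x y\<close> formed by two adjacent letters when \<open>d e\<close> becomes
  \<open>e d\<close>; for \<open>d = e\<close> the two terms cancel.
\<close>

definition swap_gain :: "'a \<Rightarrow> 'a \<Rightarrow> 'a \<Rightarrow> 'a \<Rightarrow> int" where
  "swap_gain x y d e = of_bool (d = y \<and> e = x) - of_bool (d = x \<and> e = y)"

lemma swap_gain_flip: "swap_gain x y e d = - swap_gain x y d e"
  by (simp add: swap_gain_def conj_commute)

lemma subword_count_two_adjacent_swap:
  "int (subword_count [x, y] (u @ [e, d] @ v)) = int (subword_count [x, y] (u @ [d, e] @ v)) + swap_gain x y d e"
proof (induction u)
  case Nil
  show ?case
    by (cases "d = x"; cases "e = x"; cases "d = y"; cases "e = y";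
        simp add: swap_gain_def subword_count_singleton)
next
  case (Cons r u)
  then show ?case by (simp add: subword_count_singleton)
qed

text \<open>
  An occurrence that uses both transposed letters consumes them as neighbouring letters of the pattern,
  because nothing lies between them. So they play the first two letters, and the third is free in the
  suffix, or the last two, and the first is free in the prefix.
\<close>

lemma subword_count_three_adjacent_swap:
  "int (subword_count [x, y, z] (u @ [e, d] @ v)) = int (subword_count [x, y, z] (u @ [d, e] @ v))
     + (swap_gain x y d e * int (count (mset v) z) + int (count (mset u) x) * swap_gain y z d e)"
proof (induction u)
  case Nil
  show ?case
    by (cases "d = x"; cases "e = x"; cases "d = y"; cases "e = y";
        simp add: swap_gain_def subword_count_singleton)
next
  case (Cons r u)
  show ?case
    using Cons.IH subword_count_two_adjacent_swap[of y z u e d v]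
    by (cases "x = r") (simp_all add: distrib_right)
qed

section \<open>Simultaneous disjoint adjacent transpositions\<close>

text \<open>
  A set of pairwise disjoint pairs of adjacent positions is given by the set \<open>Q\<close> of their left
  positions; disjointness then says that \<open>Q\<close> contains no two consecutive numbers.
\<close>

definition swaps_pairs :: "nat set \<Rightarrow> 'a list \<Rightarrow> 'a list \<Rightarrow> bool" where
  "swaps_pairs Q w w' \<longleftrightarrow> length w' = length w \<and>
     (\<forall>q\<in>Q. Suc q < length w \<and> Suc q \<notin> Q \<and> w' ! q = w ! Suc q \<and> w' ! Suc q = w ! q) \<and>
     (\<forall>i<length w. i \<notin> Q \<longrightarrow> i \<notin> Suc ` Q \<longrightarrow> w' ! i = w ! i)"

text \<open>
  The transpositions can be carried out one after the other, and any one of them can be taken to be the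
  last. The letters \<open>d\<close> and \<open>e\<close> that it meets are still those of \<open>w\<close>, since no other pair
  touches their positions.
\<close>

lemma swaps_pairs_insertE:
  assumes "swaps_pairs (insert q Q) w w'" and "q \<notin> Q"
  obtains u d e v where "w' = u @ [e, d] @ v" and "swaps_pairs Q w (u @ [d, e] @ v)"
    and "length u = q" and "d = w ! q" and "e = w ! Suc q"
proof -
  have len: "length w' = length w" and q: "Suc q < length w"
    and w'q: "w' ! q = w ! Suc q" "w' ! Suc q = w ! q"
    using assms(1) by (auto simp: swaps_pairs_def)
  let ?u = "take q w'" and ?v = "drop (q + 2) w'"
  define w0 where "w0 = ?u @ [w ! q, w ! Suc q] @ ?v"
  have "w' = ?u @ w' ! q # w' ! Suc q # ?v"
    using q len by (simp add: Cons_nth_drop_Suc)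
  then have w': "w' = ?u @ [w ! Suc q, w ! q] @ ?v" using w'q by simp
  have nth: "w0 ! i = (if i = q then w ! q else if i = Suc q then w ! Suc q else w' ! i)"
    if "i < length w" for i
  proof (cases "i < q + 2")
    case True
    then show ?thesis using q len by (auto simp: w0_def nth_append less_Suc_eq)
  next
    case False
    then obtain l where "i = q + 2 + l" using le_Suc_ex not_less by blast
    then show ?thesis using that q len by (simp add: w0_def nth_append)
  qed
  have lw: "length w0 = length w" using q len by (simp add: w0_def)
  have "swaps_pairs Q w w0"
    unfolding swaps_pairs_def
  proof (intro conjI ballI allI impI)
    fix r assume r: "r \<in> Q"
    then have "r \<noteq> q" "Suc r \<noteq> q" "r \<noteq> Suc q" "Suc r < length w" "Suc r \<notin> Q"
      "w' ! r = w ! Suc r" "w' ! Suc r = w ! r"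
      using assms by (auto simp: swaps_pairs_def)
    then show "Suc r < length w" "Suc r \<notin> Q" "w0 ! r = w ! Suc r" "w0 ! Suc r = w ! r"
      by (simp_all add: nth)
  next
    fix i assume "i < length w" "i \<notin> Q" "i \<notin> Suc ` Q"
    then show "w0 ! i = w ! i"
      using assms(1) by (auto simp: nth swaps_pairs_def)
  qed (rule lw)
  moreover have "length ?u = q" using q len by simp
  ultimately show ?thesis using that[OF w'] by (simp add: w0_def)
qed

lemma swaps_pairs_empty: "swaps_pairs {} w w' \<Longrightarrow> w' = w"
  by (auto simp: swaps_pairs_def intro: nth_equalityI)

text \<open>
  A transposition exchanges letters between a prefix and the rest of the word only if the prefix ends
  in the middle of the transposed pair.
\<close>

lemma mset_take_swaps_pairs:
  assumes "finite Q" and "swaps_pairs Q w w'" and "m \<notin> Suc ` Q"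
  shows "mset (take m w') = mset (take m w)"
  using assms
proof (induction Q arbitrary: w' rule: finite_induct)
  case empty
  then have "w' = w" using swaps_pairs_empty by blast
  then show ?case by simp
next
  case (insert q Q)
  obtain u d e v where *: "w' = u @ [e, d] @ v" "swaps_pairs Q w (u @ [d, e] @ v)" "length u = q"
    by (rule swaps_pairs_insertE[OF insert.prems(1) insert.hyps(2)])
  have "mset (take m w') = mset (take m (u @ [d, e] @ v))"
  proof (cases "m \<le> q")
    case False
    have "m \<noteq> Suc q" using insert.prems(2) by simp
    then have "q + 2 \<le> m" using False by simp
    then obtain l where "m = q + 2 + l" using le_Suc_ex by blast
    then show ?thesis using *(1,3) by simp
  next
    case True
    then show ?thesis using *(1,3) by simp
  qed
  also have "\<dots> = mset (take m w)"
    by (rule insert.IH[OF *(2)]) (use insert.prems(2) in simp)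
  finally show ?case .
qed

lemma mset_swaps_pairs:
  assumes "finite Q" and "swaps_pairs Q w w'"
  shows "mset w' = mset w"
proof -
  have "length w \<notin> Suc ` Q" using assms(2) by (auto simp: swaps_pairs_def)
  from mset_take_swaps_pairs[OF assms this] show ?thesis
    using assms(2) by (simp add: swaps_pairs_def)
qed

lemma mset_drop_swaps_pairs:
  assumes "finite Q" and "swaps_pairs Q w w'" and "m \<notin> Suc ` Q"
  shows "mset (drop m w') = mset (drop m w)"
proof -
  have "mset w' = mset w" by (rule mset_swaps_pairs[OF assms(1,2)])
  then have "mset (take m w') + mset (drop m w') = mset (take m w) + mset (drop m w)"
    by (metis append_take_drop_id mset_append)
  then show ?thesis using mset_take_swaps_pairs[OF assms] by simp
qed

text \<open>
  The transpositions do not interact: if the effect \<open>D\<close> of one of them depends only on its two letters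
  and on which letters, in whatever order, stand to its left and to its right, then these data are the
  same in \<open>w\<close> as at the moment when it is carried out.
\<close>

lemma swaps_pairs_additive:
  fixes F :: "'a list \<Rightarrow> int"
  assumes step: "\<And>u d e v. F (u @ [e, d] @ v) = F (u @ [d, e] @ v) + D (mset u) d e (mset v)"
    and "finite Q" and "swaps_pairs Q w w'"
  shows "F w' = F w + (\<Sum>q\<in>Q. D (mset (take q w)) (w ! q) (w ! Suc q) (mset (drop (q + 2) w)))"
  using assms(2,3)
proof (induction Q arbitrary: w' rule: finite_induct)
  case empty
  then have "w' = w" by (rule swaps_pairs_empty)
  then show ?case by simp
next
  case (insert q Q)
  obtain u d e v where *: "w' = u @ [e, d] @ v" "swaps_pairs Q w (u @ [d, e] @ v)" "length u = q"
      "d = w ! q" "e = w ! Suc q"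
    by (rule swaps_pairs_insertE[OF insert.prems insert.hyps(2)])
  have "q \<notin> Suc ` Q" "q + 2 \<notin> Suc ` Q"
    using insert.prems by (auto simp: swaps_pairs_def)
  then have "mset u = mset (take q w)" "mset v = mset (drop (q + 2) w)"
    using mset_take_swaps_pairs[OF insert.hyps(1) *(2), of q]
      mset_drop_swaps_pairs[OF insert.hyps(1) *(2), of "q + 2"] *(3)
    by simp_all
  then have "F w' = F (u @ [d, e] @ v) +
      D (mset (take q w)) (w ! q) (w ! Suc q) (mset (drop (q + 2) w))"
    using step[of u e d v] *(1,4,5) by simp
  then show ?case
    using insert.IH[OF *(2)] insert.hyps by simp
qed

section \<open>Factors with two displayed pairs\<close>

definition pair_starts :: "nat \<Rightarrow> 'a list \<Rightarrow> nat set" where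
  "pair_starts p x = {p, p + length x + 2}"

lemma end_positions_pair_starts:
  "end_positions ([d, e] @ x @ [e', d']) p = pair_starts p x \<union> Suc ` pair_starts p x"
  by (auto simp: end_positions_def pair_starts_def)

text \<open>
  Both pairs of a factor are evaluated in the original word. The letters common to their contexts are
  \<open>y\<close> on the left and \<open>z\<close> on the right; they differ by the interior \<open>x\<close> and by one copy of
  the other pair. The words \<open>y\<close> and \<open>z\<close> will not matter in the end, so they are left abstract.
\<close>

lemma factor_pair_gain:
  fixes D :: "'a multiset \<Rightarrow> 'a \<Rightarrow> 'a \<Rightarrow> 'a multiset \<Rightarrow> int"
  assumes "factor_at ([d, e] @ x @ [e, d]) p w"
  obtains y z where "(\<Sum>q\<in>pair_starts p x. D (mset (take q w)) (w ! q) (w ! Suc q) (mset (drop (q + 2) w)))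
    = D (mset y) d e (mset x + {#d, e#} + mset z) + D (mset y + {#d, e#} + mset x) e d (mset z)"
proof -
  obtain y z where w: "w = y @ ([d, e] @ x @ [e, d]) @ z" and p: "length y = p"
    using assms by (auto simp: factor_at_def)
  let ?q = "p + length x + 2"
  have w2: "w = (y @ [d, e] @ x) @ [e, d] @ z" and q: "length (y @ [d, e] @ x) = ?q"
    using w p by auto
  have at_p: "take p w = y" "w ! p = d" "w ! Suc p = e" "drop (p + 2) w = x @ [e, d] @ z"
    using w p by (auto simp: nth_append)
  have at_q: "take ?q w = y @ [d, e] @ x" "w ! ?q = e" "w ! Suc ?q = d" "drop (?q + 2) w = z"
    unfolding w2 q[symmetric] by (simp_all add: nth_append numeral_eq_Suc)
  have "(\<Sum>q\<in>pair_starts p x. D (mset (take q w)) (w ! q) (w ! Suc q) (mset (drop (q + 2) w)))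
    = D (mset (take p w)) (w ! p) (w ! Suc p) (mset (drop (p + 2) w))
    + D (mset (take ?q w)) (w ! ?q) (w ! Suc ?q) (mset (drop (?q + 2) w))"
    by (simp add: pair_starts_def)
  also have "\<dots> = D (mset y) d e (mset x + {#d, e#} + mset z) + D (mset y + {#d, e#} + mset x) e d (mset z)"
    unfolding at_p at_q by (simp add: add_mset_commute)
  finally show ?thesis by (rule that)
qed

text \<open>
  Two pairs from different factors cannot share a position because the end positions of the factors are
  disjoint; the two pairs of one factor are at least two positions apart, even when the interior is
  empty. This holds although factors may be nested, since only end positions are prescribed.
\<close>

lemma swaps_pairs_of_rewrites_to:
  assumes "\<And>k. k \<in> K \<Longrightarrow> factor_at ([d k, e k] @ x k @ [e k, d k]) (p k) w"
    and "\<And>k. k \<in> K \<Longrightarrow> \<beta> k = [d k, e k] @ x k @ [e k, d k]"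
    and "\<And>k. k \<in> K \<Longrightarrow> \<beta>' k = [e k, d k] @ x k @ [d k, e k]"
    and "\<And>m n. m \<in> K \<Longrightarrow> n \<in> K \<Longrightarrow> m \<noteq> n \<Longrightarrow>
           end_positions (\<beta> m) (p m) \<inter> end_positions (\<beta> n) (p n) = {}"
    and "rewrites_to K p \<beta> \<beta>' w w'"
  shows "swaps_pairs (\<Union>k\<in>K. pair_starts (p k) (x k)) w w'"
proof -
  let ?Q = "\<Union>k\<in>K. pair_starts (p k) (x k)"
  have ends: "end_positions (\<beta> k) (p k) = pair_starts (p k) (x k) \<union> Suc ` pair_starts (p k) (x k)"
    if "k \<in> K" for k
    unfolding assms(2)[OF that] by (rule end_positions_pair_starts)
  have "(\<Union>k\<in>K. end_positions (\<beta> k) (p k)) = ?Q \<union> Suc ` ?Q"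
    by (simp add: ends UN_Un_distrib image_UN)
  then have outside: "w' ! i = w ! i" if "i < length w" "i \<notin> ?Q" "i \<notin> Suc ` ?Q" for i
    using that assms(5) by (auto simp: rewrites_to_def)
  have inside: "Suc q < length w \<and> Suc q \<notin> ?Q \<and> w' ! q = w ! Suc q \<and> w' ! Suc q = w ! q"
    if k: "k \<in> K" and q: "q \<in> pair_starts (p k) (x k)" for k q
  proof -
    obtain y z where w: "w = y @ ([d k, e k] @ x k @ [e k, d k]) @ z" and p: "length y = p k"
      using assms(1)[OF k] by (auto simp: factor_at_def)
    let ?r = "p k + length (x k) + 2"
    have w2: "w = (y @ [d k, e k] @ x k) @ [e k, d k] @ z"
      and r: "length (y @ [d k, e k] @ x k) = ?r" using w p by auto
    have wp: "w ! p k = d k" "w ! Suc (p k) = e k" using w p by (auto simp: nth_append)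
    have wr: "w ! ?r = e k" "w ! Suc ?r = d k"
      unfolding w2 r[symmetric] by (auto simp: nth_append)
    have "\<forall>i\<in>end_positions (\<beta> k) (p k). w' ! i = \<beta>' k ! (i - p k)"
      using assms(5) k by (auto simp: rewrites_to_def)
    then have w': "w' ! i = ([e k, d k] @ x k @ [d k, e k]) ! (i - p k)"
      if "i \<in> {p k, Suc (p k), ?r, Suc ?r}" for i
      using that ends[OF k] assms(3)[OF k] by (auto simp: pair_starts_def)
    have "w' ! p k = e k" "w' ! Suc (p k) = d k" "w' ! ?r = d k" "w' ! Suc ?r = e k"
      using w'[of "p k"] w'[of "Suc (p k)"] w'[of ?r] w'[of "Suc ?r"]
      by (auto simp: nth_append)
    moreover have "Suc ?r < length w" using w p by simp
    moreover have "Suc q \<notin> ?Q"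
    proof
      assume "Suc q \<in> ?Q"
      then obtain n where n: "n \<in> K" "Suc q \<in> pair_starts (p n) (x n)" by blast
      then have "Suc q \<in> end_positions (\<beta> k) (p k) \<inter> end_positions (\<beta> n) (p n)"
        using ends k q by blast
      then have "n = k" using assms(4) k n by blast
      then show False using n q by (auto simp: pair_starts_def)
    qed
    ultimately show ?thesis using q wp wr by (auto simp: pair_starts_def)
  qed
  show ?thesis
    unfolding swaps_pairs_def using inside outside assms(5)
    by (auto simp: rewrites_to_def)
qed

text \<open>
  The contexts \<open>Y\<close> and \<open>Z\<close> cancel between the two pairs, and so do the letters \<open>d, e\<close>: a
  coefficient such as \<open>swap_gain x1 x2 d e\<close> vanishes unless \<open>{d, e} = {x1, x2}\<close>, and then neither
  letter is the \<open>x3\<close> that is being counted.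
\<close>

lemma factor_gain_three:
  assumes "distinct [x1, x2, x3]"
  shows "swap_gain x1 x2 d e * int (count (X + {#d, e#} + Z) x3) + int (count Y x1) * swap_gain x2 x3 d e
     + (swap_gain x1 x2 e d * int (count Z x3) + int (count (Y + {#d, e#} + X) x1) * swap_gain x2 x3 e d)
     = swap_gain x1 x2 d e * int (count X x3) - swap_gain x2 x3 d e * int (count X x1)"
  using assms
  by (cases "d = x1"; cases "d = x2"; cases "d = x3"; cases "e = x1"; cases "e = x2"; cases "e = x3";
      simp add: swap_gain_def algebra_simps)

lemma subword_count_rewrites_to:
  fixes d e :: "nat \<Rightarrow> 'a"
  assumes "finite K"
    and "\<And>k. k \<in> K \<Longrightarrow> \<beta> k = [d k, e k] @ x k @ [e k, d k]"
    and "\<And>k. k \<in> K \<Longrightarrow> \<beta>' k = [e k, d k] @ x k @ [d k, e k]"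
    and "\<And>k. k \<in> K \<Longrightarrow> factor_at (\<beta> k) (p k) w"
    and "\<And>m n. m \<in> K \<Longrightarrow> n \<in> K \<Longrightarrow> m \<noteq> n \<Longrightarrow>
           end_positions (\<beta> m) (p m) \<inter> end_positions (\<beta> n) (p n) = {}"
    and "rewrites_to K p \<beta> \<beta>' w w'"
  shows "subword_count [x1] w' = subword_count [x1] w" and "subword_count [x1, x2] w' = subword_count [x1, x2] w"
    and "distinct [x1, x2, x3] \<Longrightarrow> int (subword_count [x1, x2, x3] w') = int (subword_count [x1, x2, x3] w) +
      (\<Sum>k\<in>K. swap_gain x1 x2 (d k) (e k) * int (count_list (x k) x3)
             - swap_gain x2 x3 (d k) (e k) * int (count_list (x k) x1))"
proof -
  let ?S = "\<lambda>k. pair_starts (p k) (x k)"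
  let ?Q = "\<Union>k\<in>K. ?S k"
  have factor: "factor_at ([d k, e k] @ x k @ [e k, d k]) (p k) w" if "k \<in> K" for k
    using assms(2,4) that by metis
  have swaps: "swaps_pairs ?Q w w'"
    by (rule swaps_pairs_of_rewrites_to[OF factor assms(2,3,5,6)])
  have finQ: "finite ?Q" using assms(1) by (simp add: pair_starts_def)
  have sumQ: "(\<Sum>q\<in>?Q. g q) = (\<Sum>k\<in>K. \<Sum>q\<in>?S k. g q)" for g :: "nat \<Rightarrow> int"
  proof (rule sum.UNION_disjoint[OF assms(1)])
    have "?S k \<subseteq> end_positions (\<beta> k) (p k)" if "k \<in> K" for k
      unfolding assms(2)[OF that] end_positions_pair_starts by blast
    then show "\<forall>m\<in>K. \<forall>n\<in>K. m \<noteq> n \<longrightarrow> ?S m \<inter> ?S n = {}"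
      using assms(5) by blast
  qed (simp add: pair_starts_def)
  have "mset w' = mset w" by (rule mset_swaps_pairs[OF finQ swaps])
  then show "subword_count [x1] w' = subword_count [x1] w" by (simp add: subword_count_singleton)
  have "int (subword_count [x1, x2] w') = int (subword_count [x1, x2] w) +
      (\<Sum>k\<in>K. \<Sum>q\<in>?S k. swap_gain x1 x2 (w ! q) (w ! Suc q))"
    using swaps_pairs_additive[where F = "\<lambda>w. int (subword_count [x1, x2] w)" and D = "\<lambda>_ d e _. swap_gain x1 x2 d e",
        OF subword_count_two_adjacent_swap finQ swaps] by (simp only: sumQ)
  also have "(\<Sum>k\<in>K. \<Sum>q\<in>?S k. swap_gain x1 x2 (w ! q) (w ! Suc q)) = 0"
  proof (rule sum.neutral, rule ballI)
    fix k assume "k \<in> K"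
    from factor_pair_gain[OF factor[OF this], of "\<lambda>_ d e _. swap_gain x1 x2 d e"]
    have "(\<Sum>q\<in>?S k. swap_gain x1 x2 (w ! q) (w ! Suc q))
      = swap_gain x1 x2 (d k) (e k) + swap_gain x1 x2 (e k) (d k)" by blast
    also have "\<dots> = 0" by (simp add: swap_gain_flip[of x1 x2 "e k"])
    finally show "(\<Sum>q\<in>?S k. swap_gain x1 x2 (w ! q) (w ! Suc q)) = 0" .
  qed
  finally show "subword_count [x1, x2] w' = subword_count [x1, x2] w" by simp
  assume dist: "distinct [x1, x2, x3]"
  let ?D = "\<lambda>U d e V. swap_gain x1 x2 d e * int (count V x3) + int (count U x1) * swap_gain x2 x3 d e"
  have "int (subword_count [x1, x2, x3] w') = int (subword_count [x1, x2, x3] w) +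
      (\<Sum>k\<in>K. \<Sum>q\<in>?S k. ?D (mset (take q w)) (w ! q) (w ! Suc q) (mset (drop (q + 2) w)))"
    using swaps_pairs_additive[where F = "\<lambda>w. int (subword_count [x1, x2, x3] w)" and D = ?D,
        OF subword_count_three_adjacent_swap finQ swaps] by (simp only: sumQ)
  also have "(\<Sum>k\<in>K. \<Sum>q\<in>?S k. ?D (mset (take q w)) (w ! q) (w ! Suc q) (mset (drop (q + 2) w)))
    = (\<Sum>k\<in>K. swap_gain x1 x2 (d k) (e k) * int (count_list (x k) x3)
             - swap_gain x2 x3 (d k) (e k) * int (count_list (x k) x1))"
  proof (rule sum.cong[OF refl])
    fix k assume k: "k \<in> K"
    obtain y z where "(\<Sum>q\<in>?S k. ?D (mset (take q w)) (w ! q) (w ! Suc q) (mset (drop (q + 2) w)))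
      = ?D (mset y) (d k) (e k) (mset (x k) + {#d k, e k#} + mset z)
      + ?D (mset y + {#d k, e k#} + mset (x k)) (e k) (d k) (mset z)"
      by (rule factor_pair_gain[OF factor[OF k], of ?D])
    then show "(\<Sum>q\<in>?S k. ?D (mset (take q w)) (w ! q) (w ! Suc q) (mset (drop (q + 2) w)))
      = swap_gain x1 x2 (d k) (e k) * int (count_list (x k) x3)
      - swap_gain x2 x3 (d k) (e k) * int (count_list (x k) x1)"
      unfolding factor_gain_three[OF dist] by (simp add: count_mset)
  qed
  finally show "int (subword_count [x1, x2, x3] w') = int (subword_count [x1, x2, x3] w) +
      (\<Sum>k\<in>K. swap_gain x1 x2 (d k) (e k) * int (count_list (x k) x3)
             - swap_gain x2 x3 (d k) (e k) * int (count_list (x k) x1))" .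
qed

section \<open>Strong equivalence\<close>

theorem theorem3p11:
  fixes a b c :: 'a
    and w w' :: "'a list"
    and t t' t'' :: nat
    and x \<beta> \<beta>' :: "nat \<Rightarrow> 'a list"
    and p :: "nat \<Rightarrow> nat"
  assumes "distinct [a, b, c]"
    and "w \<in> lists {a, b, c}" and "w' \<in> lists {a, b, c}"
    and "1 \<le> t" and "t' \<le> t''" and "t'' \<le> t"
    and "\<And>k. k \<in> {1..t'} \<Longrightarrow> \<beta> k = [a, b] @ x k @ [b, a]"
    and "\<And>k. k \<in> {t' + 1..t''} \<Longrightarrow> \<beta> k = [b, c] @ x k @ [c, b]"
    and "\<And>k. k \<in> {t'' + 1..t} \<Longrightarrow> \<beta> k = [c, a] @ x k @ [a, c]"
    and "\<And>k. k \<in> {1..t} \<Longrightarrow> factor_at (\<beta> k) (p k) w"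
    and "\<And>k. k \<in> {1..t} \<Longrightarrow> x k \<in> lists {a, b, c}"
    and "\<And>m n. m \<in> {1..t} \<Longrightarrow> n \<in> {1..t} \<Longrightarrow> m \<noteq> n \<Longrightarrow>
           end_positions (\<beta> m) (p m) \<inter> end_positions (\<beta> n) (p n) = {}"
    and "(\<Sum>k = 1..t'. count_list (x k) c) = (\<Sum>k = t' + 1..t''. count_list (x k) a)"
    and "(\<Sum>k = t' + 1..t''. count_list (x k) a) = (\<Sum>k = t'' + 1..t. count_list (x k) b)"
    and "\<And>k. k \<in> {1..t'} \<Longrightarrow> \<beta>' k = [b, a] @ x k @ [a, b]"
    and "\<And>k. k \<in> {t' + 1..t''} \<Longrightarrow> \<beta>' k = [c, b] @ x k @ [b, c]"
    and "\<And>k. k \<in> {t'' + 1..t} \<Longrightarrow> \<beta>' k = [a, c] @ x k @ [c, a]"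
    and "rewrites_to {1..t} p \<beta> \<beta>' w w'"
  shows "strongly_M_equivalent {a, b, c} w w'"
proof -
  define d where "d k = (if k \<le> t' then a else if k \<le> t'' then b else c)" for k
  define e where "e k = (if k \<le> t' then b else if k \<le> t'' then c else a)" for k
  have \<beta>: "\<beta> k = [d k, e k] @ x k @ [e k, d k]" if "k \<in> {1..t}" for k
    using that assms(7)[of k] assms(8)[of k] assms(9)[of k] by (auto simp: d_def e_def)
  have \<beta>': "\<beta>' k = [e k, d k] @ x k @ [d k, e k]" if "k \<in> {1..t}" for k
    using that assms(15)[of k] assms(16)[of k] assms(17)[of k] by (auto simp: d_def e_def)
  have one: "subword_count [x1] w' = subword_count [x1] w" for x1
    by (rule subword_count_rewrites_to(1)[OF finite_atLeastAtMost \<beta> \<beta>' assms(10,12,18)]) assumption+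
  have two: "subword_count [x1, x2] w' = subword_count [x1, x2] w" for x1 x2
    by (rule subword_count_rewrites_to(2)[OF finite_atLeastAtMost \<beta> \<beta>' assms(10,12,18)]) assumption+
  have change: "int (subword_count [x1, x2, x3] w') = int (subword_count [x1, x2, x3] w) +
      (\<Sum>k = 1..t. swap_gain x1 x2 (d k) (e k) * int (count_list (x k) x3)
                - swap_gain x2 x3 (d k) (e k) * int (count_list (x k) x1))"
    if "distinct [x1, x2, x3]" for x1 x2 x3
    by (rule subword_count_rewrites_to(3)[OF finite_atLeastAtMost \<beta> \<beta>' assms(10,12,18) that]) assumption+
  let ?C = "\<lambda>I s. \<Sum>k\<in>I. int (count_list (x k) s)"
  have split: "{1..t} = {1..t'} \<union> ({t' + 1..t''} \<union> {t'' + 1..t})"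
    using assms(5,6) by auto
  have parts: "(\<Sum>k = 1..t. g k) = (\<Sum>k = 1..t'. g k) + ((\<Sum>k = t' + 1..t''. g k) + (\<Sum>k = t'' + 1..t. g k))"
    for g :: "nat \<Rightarrow> int"
    unfolding split using assms(5) by (subst sum.union_disjoint; auto)+
  have balanced: "?C {1..t'} c = ?C {t' + 1..t''} a" "?C {t' + 1..t''} a = ?C {t'' + 1..t} b"
    using assms(13,14) by (metis of_nat_sum)+
  have three: "subword_count [x1, x2, x3] w' = subword_count [x1, x2, x3] w"
    if dist: "distinct [x1, x2, x3]" and abc: "{x1, x2, x3} = {a, b, c}" for x1 x2 x3
  proof -
    let ?g = "\<lambda>d e I. swap_gain x1 x2 d e * ?C I x3 - swap_gain x2 x3 d e * ?C I x1"
    let ?h = "\<lambda>I. \<Sum>k\<in>I. swap_gain x1 x2 (d k) (e k) * int (count_list (x k) x3)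
        - swap_gain x2 x3 (d k) (e k) * int (count_list (x k) x1)"
    have const: "?h I = ?g s r I" if "\<And>k. k \<in> I \<Longrightarrow> d k = s \<and> e k = r" for I s r
    proof -
      have "?h I = (\<Sum>k\<in>I. swap_gain x1 x2 s r * int (count_list (x k) x3)
          - swap_gain x2 x3 s r * int (count_list (x k) x1))"
        by (rule sum.cong) (use that in auto)
      also have "\<dots> = ?g s r I"
        by (simp only: sum_subtractf sum_distrib_left)
      finally show ?thesis .
    qed
    have "?h {1..t'} = ?g a b {1..t'}"
      by (rule const) (simp add: d_def e_def)
    moreover have "?h {t' + 1..t''} = ?g b c {t' + 1..t''}"
      by (rule const) (simp add: d_def e_def)
    moreover have "?h {t'' + 1..t} = ?g c a {t'' + 1..t}"
      using assms(5) by (intro const) (simp add: d_def e_def)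
    ultimately have "int (subword_count [x1, x2, x3] w') = int (subword_count [x1, x2, x3] w) +
        (?g a b {1..t'} + (?g b c {t' + 1..t''} + ?g c a {t'' + 1..t}))"
      unfolding change[OF dist] parts by (simp only:)
    also have "?g a b {1..t'} + (?g b c {t' + 1..t''} + ?g c a {t'' + 1..t}) = 0"
    proof -
      \<comment> \<open>For the cyclic orders \<open>abc, bca, cab\<close>, the kind with the letters of \<open>x1 x2\<close> loses what
        the kind with the letters of \<open>x2 x3\<close> gains; for their reversals it is the other way round.\<close>
      have "x1 \<in> {a, b, c}" "x2 \<in> {a, b, c}" "x3 \<in> {a, b, c}"
        unfolding abc[symmetric] by simp_all
      then have orders: "[x1, x2, x3] \<in> {[a, b, c], [b, c, a], [c, a, b], [a, c, b], [c, b, a], [b, a, c]}"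
        using dist by - (elim insertE emptyE; simp)
      have "a \<noteq> b" "b \<noteq> a" "a \<noteq> c" "c \<noteq> a" "b \<noteq> c" "c \<noteq> b"
        using assms(1) by auto
      then show ?thesis
        using balanced orders by - (elim insertE emptyE; simp add: swap_gain_def)
    qed
    finally show ?thesis by simp
  qed
  show ?thesis
    unfolding strongly_M_equivalent_def
  proof (intro allI impI)
    fix as assume as: "distinct as \<and> set as = {a, b, c}"
    then have "length as = 3" using assms(1) distinct_card[of as] by auto
    then obtain x1 x2 x3 where eq: "as = [x1, x2, x3]"
      by (auto simp: numeral_3_eq_3 length_Suc_conv)
    have "subword_count [x1, x2, x3] w' = subword_count [x1, x2, x3] w"
      using as unfolding eq by (intro three) simp_all
    then show "M_equivalent as w w'"
      unfolding eq by (intro M_equivalent_ternary) (simp_all add: one two)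
  qed
qed

end
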